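(* Let $(S,* )$ be an adequate partial semigroup, let $\mathcal{F}$ be the set of adequate sequences in $S$, let $r$ be an idempotent in $J(S)$ (so $r\in J(S)\subseteq\delta S$ and $r*r=r$), and let $R:\mathcal{P}_f(\mathcal{F})\to r$ be a function (so $R(F)\subseteq S$ is a member of the ultrafilter $r$ for every $F\in\mathcal{P}_f(\mathcal{F})$). Then there exist functions $m^{*}:\mathcal{P}_f(\mathcal{F})\to\mathbb{N}$, $\alpha\in\times_{F\in\mathcal{P}_f(\mathcal{F})}S^{m^{*}(F)+1}$ and $\tau\in\times_{F\in\mathcal{P}_f(\mathcal{F})}\mathcal{J}_{m^{*}(F)}$ such that (1) if $F,G\in\mathcal{P}_f(\mathcal{F})$ and $G\subsetneq F$, then $\tau(G)(m^{*}(G))<\tau(F)(1)$; and (2) if $s\in\mathbb{N}$, $G_1,G_2,\ldots,G_s\in\mathcal{P}_f(\mathcal{F})$, $G_1\subsetneq G_2\subsetneq\cdots\subsetneq G_s$, and for each $i\in\{1,2,\ldots,s\}$, $f_i\in G_i$, then $$\prod_{i=1}^{s}\left(\left(\prod_{j=1}^{m^{*}(G_i)}\alpha(G_i)(j)*f_i\big(\tau(G_i)(j)\big)\right)*\alpha(G_i)\big(m^{*}(G_i)+1\big)\right)\in R(G_1)$$ (in particular, the product is defined).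
   Context: $\mathbb{N}=\{1,2,3,\ldots\}$. For a set $A$, $\mathcal{P}_f(A)$ is the set of nonempty finite subsets of $A$. For $m\in\mathbb{N}$, $\mathcal{J}_m=\{t\in\mathbb{N}^m: t(1)<t(2)<\cdots<t(m)\}$. A partial semigroup is a pair $(S,* )$ where $*$ maps a subset of $S\times S$ to $S$ and for all $a,b,c\in S$, $(a*b)*c=a*(b*c)$ in the sense that if either side is defined, then so is the other and they are equal. For $s\in S$, $\varphi(s)=\{t\in S: s*t \text{ is defined}\}$. For $H\in\mathcal{P}_f(S)$, $\sigma(H)=\bigcap_{s\in H}\varphi(s)$, and $\sigma(\emptyset)=S$. For $s\in S$ and $A\subseteq S$, $s^{-1}A=\{t\in\varphi(s): s*t\in A\}$. $(S,* )$ is adequate if $\sigma(H)\neq\emptyset$ for all $H\in\mathcal{P}_f(S)$. Products $\prod$ are taken in increasing order of indices; $\prod_{j=1}^{m}a(j)*f(t(j))$ means $a(1)*f(t(1))*a(2)*f(t(2))*\cdots*a(m)*f(t(m))$. A statement that a product belongs to a set includes the assertion that the product is defined. $\beta S$ is the set of ultrafilters on $S$. $\delta S=\{p\in\beta S:\varphi(x)\in p\text{ for all }x\in S\}$. For $p,q\in\delta S$, $p*q=\{A\subseteq S:\{a\in S: a^{-1}A\in q\}\in p\}$; with this operation $\delta S$ is a (compact right topological) semigroup. A sequence $f:\mathbb{N}\to S$ is adequate if (i) for each $H\in\mathcal{P}_f(\mathbb{N})$, $\prod_{t\in H}f(t)$ is defined, and (ii) for each $F\in\mathcal{P}_f(S)$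 there exists $m\in\mathbb{N}$ such that $\prod_{t\in H}f(t)\in\sigma(F)$ for every $H\in\mathcal{P}_f(\mathbb{N})$ with $\min H\geq m$. $\mathcal{F}$ is the set of all adequate sequences in $S$. A set $A\subseteq S$ is a $J$-set if for all $F\in\mathcal{P}_f(\mathcal{F})$ and all $L\in\mathcal{P}_f(S)$ there exist $m\in\mathbb{N}$, $a\in S^{m+1}$ and $t\in\mathcal{J}_m$ such that for all $f\in F$, $\left(\prod_{i=1}^{m}a(i)*f(t(i))\right)*a(m+1)\in A\cap\sigma(L)$. $J(S)=\{p\in\delta S:\text{every }A\in p\text{ is a }J\text{-set}\}$. *)

theory Defs
  imports Main "HOL-Library.FuncSet"
begin

text \<open>
  The underlying set of the partial semigroup is the whole type \<open>'a\<close>; the partial operation is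
  \<open>mul :: 'a \<Rightarrow> 'a \<Rightarrow> 'a option\<close>, where \<open>mul a b = None\<close> means that \<open>a * b\<close> is undefined.
  The positive integers are \<open>{1..} :: nat set\<close>. Sequences and finite tuples are extensional
  functions on \<open>{1..}\<close> and on \<open>{1..n}\<close>, so that two of them are equal iff they have the
  same terms (the value at the unused index 0 carries no information).
\<close>

definition Pf :: "'b set \<Rightarrow> 'b set set" where
  "Pf A = Fpow A - {{}}"

definition increasing_tuples :: "nat \<Rightarrow> (nat \<Rightarrow> nat) set" where
  "increasing_tuples m = {t \<in> {1..m} \<rightarrow>\<^sub>E {1..}. strict_mono_on {1..m} t}"

definition partial_semigroup :: "('a \<Rightarrow> 'a \<Rightarrow> 'a option) \<Rightarrow> bool" where
  "partial_semigroup mul \<longleftrightarrow>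
     (\<forall>a b c. Option.bind (mul a b) (\<lambda>x. mul x c) = Option.bind (mul b c) (\<lambda>y. mul a y))"

definition phi :: "('a \<Rightarrow> 'a \<Rightarrow> 'a option) \<Rightarrow> 'a \<Rightarrow> 'a set" where
  "phi mul s = {t. mul s t \<noteq> None}"

definition sigma :: "('a \<Rightarrow> 'a \<Rightarrow> 'a option) \<Rightarrow> 'a set \<Rightarrow> 'a set" where
  "sigma mul H = (\<Inter>s\<in>H. phi mul s)"

definition left_quotient :: "('a \<Rightarrow> 'a \<Rightarrow> 'a option) \<Rightarrow> 'a \<Rightarrow> 'a set \<Rightarrow> 'a set" where
  "left_quotient mul s A = {t \<in> phi mul s. the (mul s t) \<in> A}"

definition adequate :: "('a \<Rightarrow> 'a \<Rightarrow> 'a option) \<Rightarrow> bool" where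
  "adequate mul \<longleftrightarrow> (\<forall>H \<in> Pf UNIV. sigma mul H \<noteq> {})"

text \<open>
  Finite products, in list order. The factors may themselves be products, so they are of type
  \<open>'a option\<close>; the product is undefined if a factor or a partial product is undefined. In a
  partial semigroup the bracketing does not matter; we bracket to the left. There is no empty
  product.
\<close>

definition pmul :: "('a \<Rightarrow> 'a \<Rightarrow> 'a option) \<Rightarrow> 'a option \<Rightarrow> 'a option \<Rightarrow> 'a option" where
  "pmul mul x y = Option.bind x (\<lambda>a. Option.bind y (\<lambda>b. mul a b))"

fun pprod :: "('a \<Rightarrow> 'a \<Rightarrow> 'a option) \<Rightarrow> 'a option list \<Rightarrow> 'a option" where
  "pprod mul [] = None"
| "pprod mul (x # xs) = foldl (pmul mul) x xs"

definition seq_prod :: "('a \<Rightarrow> 'a \<Rightarrow> 'a option) \<Rightarrow> (nat \<Rightarrow> 'a) \<Rightarrow> nat set \<Rightarrow> 'a option" where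
  "seq_prod mul f H = pprod mul (map (\<lambda>n. Some (f n)) (sorted_list_of_set H))"

text \<open>\<open>a(1) * f(t(1)) * a(2) * f(t(2)) * \<dots> * a(m) * f(t(m)) * a(m+1)\<close>\<close>

definition interleaved_prod ::
  "('a \<Rightarrow> 'a \<Rightarrow> 'a option) \<Rightarrow> nat \<Rightarrow> (nat \<Rightarrow> 'a) \<Rightarrow> (nat \<Rightarrow> nat) \<Rightarrow> (nat \<Rightarrow> 'a) \<Rightarrow> 'a option" where
  "interleaved_prod mul m a t f =
     pmul mul (pprod mul (concat (map (\<lambda>j. [Some (a j), Some (f (t j))]) [1..<m + 1])))
       (Some (a (m + 1)))"

text \<open>
  Membership of a product in a set \<open>A\<close> is written \<open>\<dots> \<in> Some ` A\<close>, which includes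
  that the product is defined.
\<close>

definition adequate_seqs :: "('a \<Rightarrow> 'a \<Rightarrow> 'a option) \<Rightarrow> (nat \<Rightarrow> 'a) set" where
  "adequate_seqs mul = {f \<in> {1..} \<rightarrow>\<^sub>E UNIV.
     (\<forall>H \<in> Pf {1..}. seq_prod mul f H \<noteq> None) \<and>
     (\<forall>F \<in> Pf UNIV. \<exists>m\<ge>1. \<forall>H \<in> Pf {1..}. m \<le> Min H \<longrightarrow>
        seq_prod mul f H \<in> Some ` sigma mul F)}"

definition J_set :: "('a \<Rightarrow> 'a \<Rightarrow> 'a option) \<Rightarrow> 'a set \<Rightarrow> bool" where
  "J_set mul A \<longleftrightarrow>
     (\<forall>F \<in> Pf (adequate_seqs mul). \<forall>L \<in> Pf UNIV.
        \<exists>m\<ge>1. \<exists>a \<in> {1..m + 1} \<rightarrow>\<^sub>E UNIV. \<exists>t \<in> increasing_tuples m.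
          \<forall>f \<in> F. interleaved_prod mul m a t f \<in> Some ` (A \<inter> sigma mul L))"

definition ultrafilter :: "'a set set \<Rightarrow> bool" where
  "ultrafilter p \<longleftrightarrow>
     UNIV \<in> p \<and> {} \<notin> p \<and>
     (\<forall>A B. A \<in> p \<and> B \<in> p \<longrightarrow> A \<inter> B \<in> p) \<and>
     (\<forall>A B. A \<in> p \<and> A \<subseteq> B \<longrightarrow> B \<in> p) \<and>
     (\<forall>A. A \<in> p \<or> - A \<in> p)"

definition delta :: "('a \<Rightarrow> 'a \<Rightarrow> 'a option) \<Rightarrow> 'a set set set" where
  "delta mul = {p. ultrafilter p \<and> (\<forall>x. phi mul x \<in> p)}"

definition ultra_mul :: "('a \<Rightarrow> 'a \<Rightarrow> 'a option) \<Rightarrow> 'a set set \<Rightarrow> 'a set set \<Rightarrow> 'a set set" where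
  "ultra_mul mul p q = {A. {a. left_quotient mul a A \<in> q} \<in> p}"

definition J_ultrafilters :: "('a \<Rightarrow> 'a \<Rightarrow> 'a option) \<Rightarrow> 'a set set set" where
  "J_ultrafilters mul = {p \<in> delta mul. \<forall>A \<in> p. J_set mul A}"

end

theory Submission
  imports Defs
begin

text \<open>
  By recursion on \<open>F\<close> along strict inclusion we choose, besides the data \<open>(m, a, t)\<close> of a
  product \<open>x F f\<close> for every \<open>f \<in> F\<close>, a set \<open>B F \<in> r\<close> with \<open>B F \<subseteq> R F\<close> such that
  \<open>x F f \<in> B F\<close>, the quotient of \<open>B F\<close> by \<open>x F f\<close> is in \<open>r\<close>, and \<open>B F\<close> is contained in the
  quotient of \<open>B G\<close> by \<open>x G g\<close> for all \<open>g \<in> G \<subset> F\<close>. A finite intersection gives \<open>B F\<close>;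
  idempotence of \<open>r\<close> makes the set of \<open>b \<in> B F\<close> whose quotient of \<open>B F\<close> is in \<open>r\<close> a member
  of \<open>r\<close>, hence a J-set, which gives the products. Multiplying a chain from the right then
  keeps every partial product inside \<open>B\<close> of its first set.
\<close>

section \<open>Finite products in a partial semigroup\<close>

lemma Pf_iff: "H \<in> Pf A \<longleftrightarrow> finite H \<and> H \<subseteq> A \<and> H \<noteq> {}"
  by (auto simp: Pf_def Fpow_def)

lemma sorted_list_of_set_image_strict_mono:
  fixes h :: "'b::linorder \<Rightarrow> 'c::linorder"
  assumes "strict_mono h" and "finite H"
  shows "sorted_list_of_set (h ` H) = map h (sorted_list_of_set H)"
proof -
  have "sorted_wrt (<) (map h (sorted_list_of_set H))"
    using strict_sorted_list_of_set[of H] assms(1)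
    by (auto simp: sorted_wrt_map strict_mono_less intro: sorted_wrt_mono_rel[rotated])
  moreover have "set (map h (sorted_list_of_set H)) = h ` H"
    using assms(2) by simp
  ultimately show ?thesis
    by (metis sorted_list_of_set.idem_if_sorted_distinct strict_sorted_iff)
qed

text \<open>With undefinedness carried by \<open>None\<close>, associativity of a partial semigroup
  becomes an equation without side conditions, so regrouping a product needs no separate argument
  about definedness.\<close>

lemma pmul_assoc:
  assumes "partial_semigroup mul"
  shows "pmul mul (pmul mul x y) z = pmul mul x (pmul mul y z)"
  using assms by (cases x; cases y; cases z) (simp_all add: pmul_def partial_semigroup_def)

text \<open>Products are bracketed to the left, but a chain is multiplied from the right, so the
  first factor has to be split off. The tail must be nonempty because the empty product is
  \<open>None\<close>.\<close>

lemma pprod_Cons: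
  assumes "partial_semigroup mul" and "xs \<noteq> []"
  shows "pprod mul (x # xs) = pmul mul x (pprod mul xs)"
proof -
  have "foldl (pmul mul) (pmul mul x y) ys = pmul mul x (foldl (pmul mul) y ys)" for y ys
    by (induction ys arbitrary: y) (simp_all add: pmul_assoc[OF assms(1)])
  then show ?thesis
    using assms(2) by (cases xs) simp_all
qed

lemma pmul_in_left_quotient:
  assumes "b \<in> Some ` left_quotient mul x A"
  shows "pmul mul (Some x) b \<in> Some ` A"
  using assms by (auto simp: pmul_def left_quotient_def phi_def)

section \<open>Translating adequate sequences and J-set witnesses\<close>

lemma seq_prod_shift:
  assumes "H \<in> Pf {1..}"
  shows "seq_prod mul (restrict (\<lambda>n. f (n + k)) {1..}) H = seq_prod mul f ((\<lambda>n. n + k) ` H)"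
proof -
  have "sorted_list_of_set ((\<lambda>n. n + k) ` H) = map (\<lambda>n. n + k) (sorted_list_of_set H)"
    using assms by (intro sorted_list_of_set_image_strict_mono) (auto simp: strict_mono_def Pf_iff)
  \<comment> \<open>\<open>H\<close> omits 0, so restricting the translate to positive indices
    changes no factor.\<close>
  moreover have "map (\<lambda>n. Some (restrict (\<lambda>n. f (n + k)) {1..} n)) (sorted_list_of_set H)
      = map (\<lambda>n. Some (f (n + k))) (sorted_list_of_set H)"
    using assms by (intro map_cong) (auto simp: Pf_iff)
  ultimately show ?thesis
    by (simp only: seq_prod_def map_map o_def)
qed

text \<open>Translation by \<open>k\<close> replaces the index set \<open>H\<close> by
  \<open>H + k\<close>, whose minimum is at least that of \<open>H\<close>; hence the threshold
  \<open>m\<close> for \<open>f\<close> also serves its translate.\<close>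

lemma adequate_seqs_shift:
  assumes "f \<in> adequate_seqs mul"
  shows "restrict (\<lambda>n. f (n + k)) {1..} \<in> adequate_seqs mul"
proof -
  have shift: "(\<lambda>n. n + k) ` H \<in> Pf {1..}" if "H \<in> Pf {1..}" for H :: "nat set"
    using that by (force simp: Pf_iff)
  have Min_shift: "Min H \<le> Min ((\<lambda>n. n + k) ` H)" if "H \<in> Pf {1..}" for H :: "nat set"
    using that by (auto simp: Pf_iff intro: trans_le_add1)
  show ?thesis
    unfolding adequate_seqs_def
  proof (intro CollectI conjI ballI)
    show "restrict (\<lambda>n. f (n + k)) {1..} \<in> {1..} \<rightarrow>\<^sub>E UNIV"
      by auto
  next
    fix H :: "nat set" assume "H \<in> Pf {1..}"
    then show "seq_prod mul (restrict (\<lambda>n. f (n + k)) {1..}) H \<noteq> None"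
      using assms shift unfolding seq_prod_shift[OF \<open>H \<in> Pf {1..}\<close>] adequate_seqs_def by blast
  next
    fix F :: "'a set" assume "F \<in> Pf UNIV"
    then obtain m where "m \<ge> 1"
      and m: "\<And>H. H \<in> Pf {1..} \<Longrightarrow> m \<le> Min H \<Longrightarrow> seq_prod mul f H \<in> Some ` sigma mul F"
      using assms unfolding adequate_seqs_def by blast
    have "seq_prod mul (restrict (\<lambda>n. f (n + k)) {1..}) H \<in> Some ` sigma mul F"
      if "H \<in> Pf {1..}" "m \<le> Min H" for H
      unfolding seq_prod_shift[OF that(1)]
      using m[OF shift[OF that(1)]] Min_shift[OF that(1)] that(2) by linarith
    with \<open>m \<ge> 1\<close> show "\<exists>m\<ge>1. \<forall>H\<in>Pf {1..}. m \<le> Min H \<longrightarrow>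
        seq_prod mul (restrict (\<lambda>n. f (n + k)) {1..}) H \<in> Some ` sigma mul F"
      by blast
  qed
qed

lemma interleaved_prod_cong:
  assumes "\<And>j. j \<in> {1..m} \<Longrightarrow> f (t j) = g (u j)"
  shows "interleaved_prod mul m a t f = interleaved_prod mul m a u g"
proof -
  have "map (\<lambda>j. [Some (a j), Some (f (t j))]) [1..<m + 1]
      = map (\<lambda>j. [Some (a j), Some (g (u j))]) [1..<m + 1]"
    using assms by (intro map_cong) auto
  then show ?thesis
    by (simp only: interleaved_prod_def)
qed

text \<open>The definition of a J-set does not control where the tuple starts. Applying it to the
  translates by \<open>k\<close> and adding \<open>k\<close> back to the resulting indices pushes
  the tuple past \<open>k\<close>.\<close>

lemma J_set_beyond:
  assumes "J_set mul A" and F: "F \<in> Pf (adequate_seqs mul)"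
  obtains m a t where "m \<ge> 1" "a \<in> {1..m + 1} \<rightarrow>\<^sub>E UNIV" "t \<in> increasing_tuples m" "k < t 1"
    "\<And>f. f \<in> F \<Longrightarrow> interleaved_prod mul m a t f \<in> Some ` A"
proof -
  define shift where "shift f = restrict (\<lambda>n. f (n + k)) {1..}" for f :: "nat \<Rightarrow> 'a"
  have "shift ` F \<in> Pf (adequate_seqs mul)"
    using F adequate_seqs_shift unfolding shift_def by (fastforce simp: Pf_iff)
  \<comment> \<open>\<open>undefined\<close> is just some element of the type, giving a legitimate
    nonempty finite choice of \<open>L\<close>.\<close>
  moreover have "{undefined} \<in> Pf UNIV"
    by (simp add: Pf_iff)
  ultimately have "\<exists>m\<ge>1. \<exists>a\<in>{1..m + 1} \<rightarrow>\<^sub>E UNIV. \<exists>t\<in>increasing_tuples m.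
      \<forall>f\<in>shift ` F. interleaved_prod mul m a t f \<in> Some ` (A \<inter> sigma mul {undefined})"
    by (intro assms(1)[unfolded J_set_def, THEN bspec, THEN bspec])
  then obtain m a t where "m \<ge> 1" and a: "a \<in> {1..m + 1} \<rightarrow>\<^sub>E UNIV"
    and t: "t \<in> increasing_tuples m"
    and prod: "\<And>f. f \<in> F \<Longrightarrow>
      interleaved_prod mul m a t (shift f) \<in> Some ` (A \<inter> sigma mul {undefined})"
    by (elim exE bexE conjE) simp
  define u where "u = restrict (\<lambda>i. t i + k) {1..m}"
  \<comment> \<open>Positivity is used twice: it lets the restricted translate evaluate at
    \<open>t i\<close> to \<open>f (t i + k)\<close>, and at \<open>i = 1\<close> it makes
    \<open>k < u 1\<close> strict.\<close>
  have t_ge: "t i \<ge> 1" if "i \<in> {1..m}" for i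
    using t that unfolding increasing_tuples_def by (force simp: PiE_iff)
  have "u \<in> increasing_tuples m"
    using t by (auto simp: increasing_tuples_def u_def strict_mono_on_def PiE_iff trans_le_add1)
  moreover have "k < u 1"
    using t_ge[of 1] \<open>m \<ge> 1\<close> by (simp add: u_def)
  moreover have "interleaved_prod mul m a u f \<in> Some ` A" if "f \<in> F" for f
  proof -
    have "interleaved_prod mul m a u f = interleaved_prod mul m a t (shift f)"
      using t_ge by (intro interleaved_prod_cong) (auto simp: u_def shift_def)
    then show ?thesis
      using prod[OF that] by auto
  qed
  ultimately show thesis
    using that \<open>m \<ge> 1\<close> a by blast
qed

section \<open>Ultrafilters and the recursion over finite sets of sequences\<close>

lemma ultrafilter_INT:
  assumes "ultrafilter p" and "finite I" and "\<And>i. i \<in> I \<Longrightarrow> A i \<in> p"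
  shows "(\<Inter>i\<in>I. A i) \<in> p"
proof -
  have "UNIV \<in> p" "\<And>A B. A \<in> p \<Longrightarrow> B \<in> p \<Longrightarrow> A \<inter> B \<in> p"
    using assms(1) by (simp_all add: ultrafilter_def)
  with assms(2,3) show ?thesis
    by (induction I rule: finite_induct) simp_all
qed

theorem theorem3p2:
  fixes mul :: "'a \<Rightarrow> 'a \<Rightarrow> 'a option"
    and r :: "'a set set"
    and R :: "(nat \<Rightarrow> 'a) set \<Rightarrow> 'a set"
  assumes "partial_semigroup mul"
    and "adequate mul"
    and "r \<in> J_ultrafilters mul"
    and "ultra_mul mul r r = r"
    and "R \<in> Pf (adequate_seqs mul) \<rightarrow> r"
  shows "\<exists>(m :: (nat \<Rightarrow> 'a) set \<Rightarrow> nat)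
          (\<alpha> :: (nat \<Rightarrow> 'a) set \<Rightarrow> nat \<Rightarrow> 'a)
          (\<tau> :: (nat \<Rightarrow> 'a) set \<Rightarrow> nat \<Rightarrow> nat).
     m \<in> Pf (adequate_seqs mul) \<rightarrow> {1..} \<and>
     \<alpha> \<in> (\<Pi> F \<in> Pf (adequate_seqs mul). {1..m F + 1} \<rightarrow>\<^sub>E UNIV) \<and>
     \<tau> \<in> (\<Pi> F \<in> Pf (adequate_seqs mul). increasing_tuples (m F)) \<and>
     (\<forall>F \<in> Pf (adequate_seqs mul). \<forall>G \<in> Pf (adequate_seqs mul).
        G \<subset> F \<longrightarrow> \<tau> G (m G) < \<tau> F 1) \<and>
     (\<forall>s\<ge>1. \<forall>(G :: nat \<Rightarrow> (nat \<Rightarrow> 'a) set) (f :: nat \<Rightarrow> nat \<Rightarrow> 'a).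
        (\<forall>i\<in>{1..s}. G i \<in> Pf (adequate_seqs mul)) \<and>
        (\<forall>i\<in>{1..<s}. G i \<subset> G (i + 1)) \<and>
        (\<forall>i\<in>{1..s}. f i \<in> G i) \<longrightarrow>
        pprod mul (map (\<lambda>i. interleaved_prod mul (m (G i)) (\<alpha> (G i)) (\<tau> (G i)) (f i)) [1..<s + 1])
          \<in> Some ` R (G 1))"
proof -
  let ?FF = "Pf (adequate_seqs mul)"
  have J: "J_set mul A" if "A \<in> r" for A
    using assms(3) that by (simp add: J_ultrafilters_def)
  have uf: "ultrafilter r"
    using assms(3) by (simp add: J_ultrafilters_def delta_def)
  have Int: "A \<inter> B \<in> r" if "A \<in> r" "B \<in> r" for A B
    using uf that by (simp add: ultrafilter_def)
  \<comment> \<open>This is the inclusion of \<open>r\<close> in \<open>r * r\<close>.\<close>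
  have quot: "{a. left_quotient mul a A \<in> r} \<in> r" if "A \<in> r" for A
    using assms(4) that by (auto simp: ultra_mul_def)
  \<comment> \<open>\<open>P D F v\<close> says that \<open>v\<close> is an admissible value at
    \<open>F\<close> given the values of \<open>D\<close> at smaller sets. It is vacuous outside
    \<open>?FF\<close>, so that the choice can be made for all sets; the guard
    \<open>G \<noteq> {}\<close> is there because the empty set carries no data.\<close>
  define P :: "((nat \<Rightarrow> 'a) set \<Rightarrow> 'a set \<times> nat \<times> (nat \<Rightarrow> 'a) \<times> (nat \<Rightarrow> nat)) \<Rightarrow>
      (nat \<Rightarrow> 'a) set \<Rightarrow> _ \<Rightarrow> bool"
    where "P D F = (\<lambda>(B, m, a, t). F \<in> ?FF \<longrightarrow>
      B \<in> r \<and> B \<subseteq> R F \<and> m \<ge> 1 \<and> a \<in> {1..m + 1} \<rightarrow>\<^sub>E UNIV \<and> t \<in> increasing_tuples m \<and>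
      (\<forall>f\<in>F. interleaved_prod mul m a t f \<in> Some ` {x \<in> B. left_quotient mul x B \<in> r}) \<and>
      (\<forall>G. G \<noteq> {} \<and> G \<subset> F \<longrightarrow> (case D G of (B', m', a', t') \<Rightarrow> t' m' < t 1 \<and>
        (\<forall>f\<in>G. B \<subseteq> left_quotient mul (the (interleaved_prod mul m' a' t' f)) B'))))" for D F
  have "\<exists>D. \<forall>F. P D F (D F)"
  \<comment> \<open>Two obligations: \<open>P\<close> at \<open>F\<close> depends on
    \<open>D\<close> only through proper subsets of \<open>F\<close>, and an admissible value exists
    once all earlier values are admissible.\<close>
  proof (rule dependent_wf_choice[OF wf_finite_psubset])
    show "P D F v = P D' F v" if "\<And>G. (G, F) \<in> finite_psubset \<Longrightarrow> D G = D' G" for D D' F v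
    proof -
      have "F \<in> ?FF \<Longrightarrow> G \<subset> F \<Longrightarrow> D G = D' G" for G
        using that by (simp add: Pf_iff)
      then show ?thesis
        by (auto simp: P_def split: prod.splits)
    qed
  next
    show "\<exists>v. P D F v" if IH: "\<And>G. (G, F) \<in> finite_psubset \<Longrightarrow> P D G (D G)" for D F
    proof (cases "F \<in> ?FF")
      case False
      then show ?thesis by (auto simp: P_def)
    next
      case True
      then have "finite F" and F: "F \<subseteq> adequate_seqs mul"
        by (simp_all add: Pf_iff)
      obtain B m a t where D: "\<And>G. D G = (B G, m G, a G, t G)"
        by (rule that[of "\<lambda>G. fst (D G)" "\<lambda>G. fst (snd (D G))" "\<lambda>G. fst (snd (snd (D G)))"
          "\<lambda>G. snd (snd (snd (D G)))"]) simp
      define Q where "Q G f = left_quotient mul (the (interleaved_prod mul (m G) (a G) (t G) f)) (B G)"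
        for G f
      \<comment> \<open>Each pair contributes one quotient to be intersected. If \<open>F\<close> is
        a singleton there are no pairs and the intersection is \<open>UNIV\<close>.\<close>
      define I where "I = (SIGMA G:{G. G \<noteq> {} \<and> G \<subset> F}. G)"
      have "I \<subseteq> Pow F \<times> F"
        by (auto simp: I_def)
      then have "finite I"
        using \<open>finite F\<close> by (meson finite_Pow_iff finite_SigmaI finite_subset)
      \<comment> \<open>The maximum runs over all of \<open>Pow F\<close>, including
        \<open>{}\<close> and \<open>F\<close>, where \<open>D\<close> may be arbitrary; this can
        only raise the bound.\<close>
      define k where "k = Max ((\<lambda>G. t G (m G)) ` Pow F)"
      have "Q G f \<in> r" if "(G, f) \<in> I" for G f
      proof -
        have "G \<in> ?FF" "(G, F) \<in> finite_psubset" "f \<in> G"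
          using that \<open>finite F\<close> F by (auto simp: I_def Pf_iff intro: finite_subset)
        with IH[of G] show ?thesis
          by (auto simp: P_def D Q_def)
      qed
      then have "(\<Inter>(G, f)\<in>I. Q G f) \<in> r"
        using \<open>finite I\<close> by (intro ultrafilter_INT[OF uf]) auto
      moreover have "R F \<in> r"
        using assms(5) True by blast
      moreover define C where "C = R F \<inter> (\<Inter>(G, f)\<in>I. Q G f)"
      ultimately have "C \<in> r"
        by (simp only: Int)
      \<comment> \<open>The second set lies in \<open>r\<close> by idempotence. Placing the new
        products in it makes their quotients of \<open>C\<close> members of \<open>r\<close>, which
        is what the recursion uses at supersets of \<open>F\<close>.\<close>
      then have "J_set mul (C \<inter> {x. left_quotient mul x C \<in> r})"
        by (intro J Int quot)
      then obtain m' a' t' where new: "m' \<ge> 1" "a' \<in> {1..m' + 1} \<rightarrow>\<^sub>E UNIV"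
          "t' \<in> increasing_tuples m'" and "k < t' 1"
        and prod: "\<And>f. f \<in> F \<Longrightarrow>
          interleaved_prod mul m' a' t' f \<in> Some ` (C \<inter> {x. left_quotient mul x C \<in> r})"
        by (rule J_set_beyond[OF _ True, of _ k]) (rule that)
      have "t G (m G) < t' 1" if "G \<subset> F" for G
      proof -
        have "t G (m G) \<le> k"
          unfolding k_def using \<open>finite F\<close> that by (intro Max_ge) auto
        with \<open>k < t' 1\<close> show ?thesis by simp
      qed
      moreover have "C \<subseteq> Q G f" if "G \<noteq> {}" "G \<subset> F" "f \<in> G" for G f
        using that by (auto simp: C_def I_def)
      ultimately have "P D F (C, m', a', t')"
        using \<open>C \<in> r\<close> new prod by (auto simp: P_def D Q_def[symmetric] C_def Int_def)
      then show ?thesis ..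
    qed
  qed
  then obtain D where D: "\<And>F. P D F (D F)"
    by blast
  obtain B m a t where D_eq: "\<And>F. D F = (B F, m F, a F, t F)"
    by (rule that[of "\<lambda>G. fst (D G)" "\<lambda>G. fst (snd (D G))" "\<lambda>G. fst (snd (snd (D G)))"
          "\<lambda>G. snd (snd (snd (D G)))"]) simp
  define x where "x F f = interleaved_prod mul (m F) (a F) (t F) f" for F f
  have B: "B F \<subseteq> R F" and m: "m F \<ge> 1" and a: "a F \<in> {1..m F + 1} \<rightarrow>\<^sub>E UNIV"
    and t: "t F \<in> increasing_tuples (m F)"
    and x: "f \<in> F \<Longrightarrow> x F f \<in> Some ` B F"
    if "F \<in> ?FF" for F f
    using D[of F] that by (auto simp: P_def D_eq x_def)
  have less: "t G (m G) < t F 1"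
    and sub: "f \<in> G \<Longrightarrow> B F \<subseteq> left_quotient mul (the (x G f)) (B G)"
    if "F \<in> ?FF" "G \<in> ?FF" "G \<subset> F" for F G f
    using D[of F] that by (auto simp: P_def D_eq x_def Pf_iff)
  have chain: "pprod mul (map (\<lambda>i. x (G i) (f i)) [1..<s + 1]) \<in> Some ` R (G 1)"
    if "s \<ge> 1" and G: "\<forall>i\<in>{1..s}. G i \<in> ?FF" and G_less: "\<forall>i\<in>{1..<s}. G i \<subset> G (i + 1)"
      and f: "\<forall>i\<in>{1..s}. f i \<in> G i" for s G f
  proof -
    \<comment> \<open>Downward induction on the first index \<open>k\<close>: the tail lies in
      \<open>B (G (Suc k))\<close>, hence in the quotient of \<open>B (G k)\<close> by the
      \<open>k\<close>-th factor, so that factor can be put in front.\<close>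
    have "1 \<le> k \<Longrightarrow> pprod mul (map (\<lambda>i. x (G i) (f i)) [k..<s + 1]) \<in> Some ` B (G k)"
      if "k \<le> s" for k
      using that
    proof (induction k rule: inc_induct)
      case base
      then show ?case using x G f by simp
    next
      case (step k)
      then have "pprod mul (map (\<lambda>i. x (G i) (f i)) [Suc k..<s + 1]) \<in> Some ` B (G (Suc k))"
        by simp
      moreover have "B (G (Suc k)) \<subseteq> left_quotient mul (the (x (G k) (f k))) (B (G k))"
        using step G G_less f by (intro sub) auto
      ultimately have "pmul mul (Some (the (x (G k) (f k))))
          (pprod mul (map (\<lambda>i. x (G i) (f i)) [Suc k..<s + 1])) \<in> Some ` B (G k)"
        by (intro pmul_in_left_quotient) blast
      \<comment> \<open>The factor is defined because it lies in the image of \<open>B (G k)\<close>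
        under \<open>Some\<close>.\<close>
      moreover have "Some (the (x (G k) (f k))) = x (G k) (f k)"
        using x[of "G k" "f k"] G f step by auto
      moreover have "[k..<s + 1] = k # [Suc k..<s + 1]"
        using step by (simp add: upt_conv_Cons)
      ultimately show ?case
        using step pprod_Cons[OF assms(1), of "map (\<lambda>i. x (G i) (f i)) [Suc k..<s + 1]"] by simp
    qed
    from this[of 1] show ?thesis
      using \<open>s \<ge> 1\<close> B[of "G 1"] G by auto
  qed
  show ?thesis
    using m a t less chain unfolding x_def
    by (intro exI[of _ m] exI[of _ a] exI[of _ t] conjI) auto
qed

end
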